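(* Let $\pi\in\mathcal S_n$ be a permutation not equal to the identity. Then $\pi$ is $132$-avoiding if and only if its diagram $D(\pi)$ consists of only one connected component and $(1,1)\in D(\pi)$.
   Context: $\mathcal S_n$ is the symmetric group on $\{1,\dots,n\}$, with permutations written as words $\pi=\pi_1\cdots\pi_n$. For $\tau\in\mathcal S_k$, $\pi$ contains the pattern $\tau$ if there are $1\le i_1<\dots<i_k\le n$ such that $\pi_{i_1}\cdots\pi_{i_k}$ is in the same relative order as $\tau_1\cdots\tau_k$; otherwise $\pi$ avoids $\tau$ (is $\tau$-avoiding). Diagram: represent $\pi$ by an $n\times n$ array of squares (rows numbered top to bottom, columns left to right) with a dot in each square $(i,\pi_i)$. Shade each dotted square and all squares due south or due east of some dot. The diagram $D(\pi)$ is the set of unshaded squares, i.e. $D(\pi)=\{(i,j): j<\pi_i \text{ and } \pi^{-1}(j)>i\}$. Connected components are taken with respect to squares sharing an edge. *)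

theory Defs
  imports "HOL-Combinatorics.Combinatorics"
begin

text \<open>
  A permutation of \<open>{1..n}\<close> is a function \<open>\<pi>\<close> with \<open>\<pi> permutes {1..n}\<close>; its word is
  \<open>\<pi> 1, \<dots>, \<pi> n\<close>.  A pattern of length \<open>k\<close> is likewise a permutation of \<open>{1..k}\<close>.
  The indices of an occurrence, \<open>i\<^sub>1 < \<dots> < i\<^sub>k\<close>, are given by the function \<open>f\<close>.
\<close>

definition contains_pattern :: "nat \<Rightarrow> (nat \<Rightarrow> nat) \<Rightarrow> nat \<Rightarrow> (nat \<Rightarrow> nat) \<Rightarrow> bool" where
  "contains_pattern k \<tau> n \<pi> \<longleftrightarrow>
     (\<exists>f. strict_mono_on {1..k} f \<and> f ` {1..k} \<subseteq> {1..n} \<and>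
          (\<forall>a\<in>{1..k}. \<forall>b\<in>{1..k}. \<pi> (f a) < \<pi> (f b) \<longleftrightarrow> \<tau> a < \<tau> b))"

definition avoids_pattern :: "nat \<Rightarrow> (nat \<Rightarrow> nat) \<Rightarrow> nat \<Rightarrow> (nat \<Rightarrow> nat) \<Rightarrow> bool" where
  "avoids_pattern k \<tau> n \<pi> \<longleftrightarrow> \<not> contains_pattern k \<tau> n \<pi>"

definition pattern132 :: "nat \<Rightarrow> nat" where
  "pattern132 = transpose 2 3"

lemma pattern132_permutes: "pattern132 permutes {1..3}"
  unfolding pattern132_def by (rule permutes_swap_id) auto

lemma pattern132_word: "map pattern132 [1, 2, 3] = [1, 3, 2]"
  by (simp add: pattern132_def transpose_def)

text \<open>
  Square \<open>(i, j)\<close> lies in row \<open>i\<close> (counted from the top) and column \<open>j\<close>.  It is shaded iff it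
  is weakly east of the dot in its row or weakly south of the dot in its column.
\<close>

definition shaded :: "nat \<Rightarrow> (nat \<Rightarrow> nat) \<Rightarrow> (nat \<times> nat) set" where
  "shaded n \<pi> = {(i, j) \<in> {1..n} \<times> {1..n}. \<exists>r\<in>{1..n}. (i = r \<and> j \<ge> \<pi> r) \<or> (j = \<pi> r \<and> i \<ge> r)}"

definition diagram :: "nat \<Rightarrow> (nat \<Rightarrow> nat) \<Rightarrow> (nat \<times> nat) set" where
  "diagram n \<pi> = {1..n} \<times> {1..n} - shaded n \<pi>"

lemma diagram_eq:
  assumes "\<pi> permutes {1..n}"
  shows "diagram n \<pi> = {(i, j) \<in> {1..n} \<times> {1..n}. j < \<pi> i \<and> inv \<pi> j > i}"
proof -
  have "(i, j) \<in> diagram n \<pi> \<longleftrightarrow> j < \<pi> i \<and> inv \<pi> j > i"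
    if ij: "i \<in> {1..n}" "j \<in> {1..n}" for i j
  proof -
    have inv_j: "inv \<pi> j \<in> {1..n}" "j = \<pi> (inv \<pi> j)"
      using permutes_in_image[OF permutes_inv[OF assms], of j] permutes_inverses(1)[OF assms, of j] ij(2)
      by simp_all
    have col: "r = inv \<pi> j" if "j = \<pi> r" for r
      using that permutes_inverses(2)[OF assms] by simp
    have "(i, j) \<in> shaded n \<pi> \<longleftrightarrow> \<pi> i \<le> j \<or> inv \<pi> j \<le> i"
    proof
      assume "(i, j) \<in> shaded n \<pi>"
      then show "\<pi> i \<le> j \<or> inv \<pi> j \<le> i"
        unfolding shaded_def using col by auto
    next
      assume "\<pi> i \<le> j \<or> inv \<pi> j \<le> i"
      then have "\<exists>r\<in>{1..n}. (i = r \<and> \<pi> r \<le> j) \<or> (j = \<pi> r \<and> r \<le> i)"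
      proof
        assume "\<pi> i \<le> j"
        then show ?thesis by (intro bexI[of _ i] ij(1)) simp
      next
        assume "inv \<pi> j \<le> i"
        then show ?thesis using inv_j by (intro bexI[of _ "inv \<pi> j"]) blast+
      qed
      then show "(i, j) \<in> shaded n \<pi>"
        unfolding shaded_def using ij by blast
    qed
    then show ?thesis
      using ij unfolding diagram_def by (simp add: not_le)
  qed
  moreover have "diagram n \<pi> \<subseteq> {1..n} \<times> {1..n}"
    unfolding diagram_def by (rule Diff_subset)
  ultimately show ?thesis by auto
qed

definition edge_adjacent :: "((nat \<times> nat) \<times> (nat \<times> nat)) set" where
  "edge_adjacent = {((i, j), (i', j')).
     (i = i' \<and> (j' = Suc j \<or> j = Suc j')) \<or> (j = j' \<and> (i' = Suc i \<or> i = Suc i'))}"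

definition connected_in :: "(nat \<times> nat) set \<Rightarrow> ((nat \<times> nat) \<times> (nat \<times> nat)) set" where
  "connected_in D = (edge_adjacent \<inter> D \<times> D)\<^sup>* \<inter> D \<times> D"

lemma equiv_connected_in: "equiv D (connected_in D)"
proof (rule equivI)
  have "sym (edge_adjacent \<inter> D \<times> D)"
    by (auto simp: sym_def edge_adjacent_def)
  then have "sym ((edge_adjacent \<inter> D \<times> D)\<^sup>*)"
    by (rule sym_rtrancl)
  then show "sym (connected_in D)"
    unfolding connected_in_def by (intro sym_Int) (auto simp: sym_def)
  show "trans (connected_in D)"
    unfolding connected_in_def by (intro trans_Int trans_rtrancl) (auto simp: trans_def)
qed (auto simp: connected_in_def refl_on_def)

definition square_components :: "(nat \<times> nat) set \<Rightarrow> (nat \<times> nat) set set" where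
  "square_components D = D // connected_in D"

end

theory Submission imports Defs begin

text \<open>
  The dot in row \<open>a\<close> shades a hook: its row eastwards and its column southwards.  Hence no walk
  inside the diagram enters the quadrant strictly south-east of a dot from outside
  (\<open>rtrancl_diagram_stays_southeast_of_dot\<close>).  If \<open>a < b < c\<close> are the positions of a 132
  occurrence, then the square in row \<open>b\<close> and column \<open>\<pi> c\<close> is unshaded and lies in the quadrant
  of the dot in row \<open>a\<close>, so it cannot be joined to the corner square \<open>(1, 1)\<close>, which lies in no
  such quadrant.

  Conversely, an unshaded square with a dot weakly to its north-west exhibits a 132 pattern: that
  dot, the dot in its row and the dot in its column.  When \<open>\<pi>\<close> avoids 132 no dot is therefore
  weakly north-west of an unshaded square, which forces the whole rectangle spanned by that square
  and the corner to be unshaded (\<open>diagram_down_closed\<close>): the diagram is a Young diagram, and each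
  of its squares is joined to the corner by walking along a row and then along the first column.
  It is non-empty because the first row moved by \<open>\<pi>\<close> has an unshaded diagonal square.
\<close>

lemma card_quotient_eq_1_iff:
  assumes "equiv A r" and "x \<in> A"
  shows "card (A // r) = 1 \<longleftrightarrow> (\<forall>y\<in>A. (x, y) \<in> r)"
proof
  assume "card (A // r) = 1"
  then obtain X where X: "A // r = {X}"
    by (auto simp: card_1_singleton_iff)
  show "\<forall>y\<in>A. (x, y) \<in> r"
  proof
    fix y assume "y \<in> A"
    with X \<open>x \<in> A\<close> have "r `` {x} = r `` {y}"
      by (metis quotientI singletonD)
    then show "(x, y) \<in> r"
      using eq_equiv_class[OF _ assms(1) \<open>y \<in> A\<close>] by blast
  qed
next
  assume "\<forall>y\<in>A. (x, y) \<in> r"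
  then have "r `` {y} = r `` {x}" if "y \<in> A" for y
    using that equiv_class_eq[OF assms(1)] by metis
  with \<open>x \<in> A\<close> have "A // r = {r `` {x}}"
    unfolding quotient_def by blast
  then show "card (A // r) = 1"
    by simp
qed

lemma contains_pattern132_iff:
  "contains_pattern 3 pattern132 n \<pi> \<longleftrightarrow>
     (\<exists>a b c. 1 \<le> a \<and> a < b \<and> b < c \<and> c \<le> n \<and> \<pi> a < \<pi> c \<and> \<pi> c < \<pi> b)"
proof -
  have three: "{1..3::nat} = {1, 2, 3}"
    by auto
  have word: "pattern132 (Suc 0) = 1" "pattern132 2 = 3" "pattern132 3 = 2"
    by (simp_all add: pattern132_def transpose_def)
  show ?thesis
  proof
    assume "contains_pattern 3 pattern132 n \<pi>"
    then obtain f where f: "strict_mono_on {1..3} f" "f ` {1..3} \<subseteq> {1..n}"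
      and order: "\<forall>a\<in>{1..3}. \<forall>b\<in>{1..3}. \<pi> (f a) < \<pi> (f b) \<longleftrightarrow> pattern132 a < pattern132 b"
      unfolding contains_pattern_def by blast
    have "f 1 < f 2" "f 2 < f 3"
      using f(1) by (auto simp: strict_mono_on_def)
    moreover have "1 \<le> f 1" "f 3 \<le> n"
      using f(2) unfolding three by auto
    moreover have "\<pi> (f 1) < \<pi> (f 3)" "\<pi> (f 3) < \<pi> (f 2)"
      using order by (auto simp: three word)
    ultimately show "\<exists>a b c. 1 \<le> a \<and> a < b \<and> b < c \<and> c \<le> n \<and> \<pi> a < \<pi> c \<and> \<pi> c < \<pi> b"
      by blast
  next
    assume "\<exists>a b c. 1 \<le> a \<and> a < b \<and> b < c \<and> c \<le> n \<and> \<pi> a < \<pi> c \<and> \<pi> c < \<pi> b"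
    then obtain a b c where abc: "1 \<le> a" "a < b" "b < c" "c \<le> n" "\<pi> a < \<pi> c" "\<pi> c < \<pi> b"
      by blast
    define f where "f = (\<lambda>k::nat. if k = 1 then a else if k = 2 then b else c)"
    have "strict_mono_on {1..3} f"
      using abc by (auto simp: strict_mono_on_def three f_def)
    moreover have "f ` {1..3} \<subseteq> {1..n}"
      using abc by (auto simp: three f_def)
    moreover have "\<forall>i\<in>{1..3}. \<forall>j\<in>{1..3}. \<pi> (f i) < \<pi> (f j) \<longleftrightarrow> pattern132 i < pattern132 j"
      using abc unfolding three by (auto simp: f_def word)
    ultimately show "contains_pattern 3 pattern132 n \<pi>"
      unfolding contains_pattern_def by blast
  qed
qed

lemma mem_diagram_iff:
  assumes "\<pi> permutes {1..n}"
  shows "(i, j) \<in> diagram n \<pi> \<longleftrightarrow> i \<in> {1..n} \<and> j \<in> {1..n} \<and> j < \<pi> i \<and> i < inv \<pi> j"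
  using diagram_eq[OF assms] by auto

text \<open>
  A step of the walk that left the quadrant would land in row \<open>a\<close> east of the dot or in column
  \<open>\<pi> a\<close> south of it, and these squares are shaded.
\<close>

lemma rtrancl_diagram_stays_southeast_of_dot:
  assumes \<pi>: "\<pi> permutes {1..n}"
    and walk: "(p, q) \<in> (edge_adjacent \<inter> diagram n \<pi> \<times> diagram n \<pi>)\<^sup>*"
    and start: "a < fst p" "\<pi> a < snd p"
  shows "a < fst q \<and> \<pi> a < snd q"
  using walk
proof (induction rule: rtrancl_induct)
  case base
  then show ?case using start by simp
next
  case (step q r)
  obtain i j where r: "r = (i, j)" by (cases r)
  have "j < \<pi> i" "i < inv \<pi> j"
    using step.hyps(2) by (auto simp: r mem_diagram_iff[OF \<pi>])
  then have "i \<noteq> a \<or> j < \<pi> a" "j \<noteq> \<pi> a \<or> i < a"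
    by (auto simp: permutes_inverses(2)[OF \<pi>])
  moreover obtain k l where q: "q = (k, l)" by (cases q)
  ultimately show ?case
    using step.hyps(2) step.IH start by (simp add: q r edge_adjacent_def) linarith
qed

text \<open>
  A dot in a row \<open>k \<le> i\<close> and a column \<open>\<le> j\<close> would form a 132 pattern with the dot in row \<open>i\<close>
  (which is east of column \<open>j\<close>) and the dot in column \<open>j\<close> (which is south of row \<open>i\<close>).  So all
  the dots in the rows up to \<open>i\<close> are east of column \<open>j\<close>, and hence none of them shades a square of
  the rectangle.
\<close>

lemma diagram_down_closed:
  assumes \<pi>: "\<pi> permutes {1..n}"
    and avoids: "avoids_pattern 3 pattern132 n \<pi>"
    and ij: "(i, j) \<in> diagram n \<pi>"
    and le: "1 \<le> i'" "i' \<le> i" "1 \<le> j'" "j' \<le> j"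
  shows "(i', j') \<in> diagram n \<pi>"
proof -
  have bounds: "i \<le> n" "j \<le> n" and row: "j < \<pi> i" and col: "i < inv \<pi> j"
    using ij by (auto simp: mem_diagram_iff[OF \<pi>])
  have inv_in: "inv \<pi> k \<in> {1..n}" if "k \<in> {1..n}" for k
    using that permutes_in_image[OF permutes_inv[OF \<pi>]] by blast
  have east: "j < \<pi> k" if k: "1 \<le> k" "k \<le> i" for k
  proof (rule ccontr)
    assume "\<not> j < \<pi> k"
    moreover have "\<pi> k \<noteq> j"
      using k col permutes_inverses(2)[OF \<pi>, of k] by auto
    ultimately have "\<pi> k < \<pi> (inv \<pi> j)"
      by (simp add: permutes_inverses(1)[OF \<pi>])
    moreover have "k < i"
      using k row \<open>\<not> j < \<pi> k\<close> by (cases "k = i") auto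
    moreover have "inv \<pi> j \<le> n"
      using inv_in[of j] bounds le by auto
    ultimately have "contains_pattern 3 pattern132 n \<pi>"
      unfolding contains_pattern132_iff using k(1) col row permutes_inverses(1)[OF \<pi>, of j]
      by (intro exI[of _ k] exI[of _ i] exI[of _ "inv \<pi> j"]) auto
    then show False
      using avoids by (simp add: avoids_pattern_def)
  qed
  have "i < inv \<pi> j'"
  proof (rule ccontr)
    assume "\<not> i < inv \<pi> j'"
    then have "j < \<pi> (inv \<pi> j')"
      using east inv_in[of j'] bounds le by auto
    then show False
      using le by (simp add: permutes_inverses(1)[OF \<pi>])
  qed
  then show ?thesis
    using east[of i'] bounds le by (auto simp: mem_diagram_iff[OF \<pi>])
qed

lemma diagram_nonempty:
  assumes \<pi>: "\<pi> permutes {1..n}" and "\<pi> \<noteq> id"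
  shows "diagram n \<pi> \<noteq> {}"
proof -
  define i where "i = (LEAST i. \<pi> i \<noteq> i)"
  have "\<exists>i. \<pi> i \<noteq> i"
    using \<open>\<pi> \<noteq> id\<close> by (auto simp: fun_eq_iff)
  then have moved: "\<pi> i \<noteq> i"
    unfolding i_def by (rule LeastI_ex)
  have fixed: "\<pi> k = k" if "k < i" for k
    using not_less_Least[of k "\<lambda>i. \<pi> i \<noteq> i"] that by (auto simp: i_def)
  have i: "i \<in> {1..n}"
    using moved \<pi> by (meson permutes_not_in)
  (* The values below i are taken by the fixed rows above row i. *)
  have "\<not> \<pi> i < i"
    using fixed[of "\<pi> i"] moved permutes_inj[OF \<pi>] by (auto dest: injD)
  moreover have "\<not> inv \<pi> i < i"
    using fixed[of "inv \<pi> i"] permutes_inverses(1)[OF \<pi>, of i] by auto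
  moreover have "inv \<pi> i \<noteq> i"
    using moved permutes_inverses(1)[OF \<pi>, of i] by auto
  ultimately have "(i, i) \<in> diagram n \<pi>"
    using moved i by (simp add: mem_diagram_iff[OF \<pi>])
  then show ?thesis by blast
qed

lemma down_closed_connected_to_corner:
  assumes closed: "\<And>i j i' j'. (i, j) \<in> D \<Longrightarrow> 1 \<le> i' \<Longrightarrow> i' \<le> i \<Longrightarrow> 1 \<le> j' \<Longrightarrow> j' \<le> j \<Longrightarrow> (i', j') \<in> D"
    and "(i, j) \<in> D" "1 \<le> i" "1 \<le> j"
  shows "((i, j), (1, 1)) \<in> (edge_adjacent \<inter> D \<times> D)\<^sup>*"
  using \<open>1 \<le> j\<close> \<open>(i, j) \<in> D\<close>
proof (induction j rule: dec_induct)
  case base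
  show ?case
    using \<open>1 \<le> i\<close> base
  proof (induction i rule: dec_induct)
    case (step i)
    then have "((Suc i, 1), (i, 1)) \<in> edge_adjacent \<inter> D \<times> D" "(i, 1) \<in> D"
      using closed[of "Suc i" 1 i 1] by (auto simp: edge_adjacent_def)
    then show ?case
      using step.IH by (blast intro: converse_rtrancl_into_rtrancl)
  qed simp
next
  case (step j)
  then have "((i, Suc j), (i, j)) \<in> edge_adjacent \<inter> D \<times> D" "(i, j) \<in> D"
    using closed[of i "Suc j" i j] \<open>1 \<le> i\<close> by (auto simp: edge_adjacent_def)
  then show ?case
    using step.IH by (blast intro: converse_rtrancl_into_rtrancl)
qed

theorem theorem2p2:
  fixes n :: nat and \<pi> :: "nat \<Rightarrow> nat"
  assumes "\<pi> permutes {1..n}" and "\<pi> \<noteq> id"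
  shows "avoids_pattern 3 pattern132 n \<pi> \<longleftrightarrow>
    card (square_components (diagram n \<pi>)) = 1 \<and> (1, 1) \<in> diagram n \<pi>"
proof
  let ?D = "diagram n \<pi>"
  assume avoids: "avoids_pattern 3 pattern132 n \<pi>"
  note closed = diagram_down_closed[OF assms(1) avoids]
  have pos: "1 \<le> i \<and> 1 \<le> j" if "(i, j) \<in> ?D" for i j
    using that by (auto simp: mem_diagram_iff[OF assms(1)])
  obtain i j where "(i, j) \<in> ?D"
    using diagram_nonempty[OF assms] by auto
  then have corner: "(1, 1) \<in> ?D"
    using closed[of i j 1 1] pos by auto
  have "(q, (1, 1)) \<in> connected_in ?D" if q: "q \<in> ?D" for q
  proof -
    obtain i j where ij: "q = (i, j)" by (cases q)
    have "((i, j), (1, 1)) \<in> (edge_adjacent \<inter> ?D \<times> ?D)\<^sup>*"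
    proof (rule down_closed_connected_to_corner)
      show "(i, j) \<in> ?D" "1 \<le> i" "1 \<le> j"
        using q pos ij by blast+
    qed (rule closed)
    then show ?thesis
      using q corner by (simp add: connected_in_def ij)
  qed
  then have "\<forall>q\<in>?D. ((1, 1), q) \<in> connected_in ?D"
    using equiv_connected_in[of ?D] by (meson equivE symE)
  then show "card (square_components ?D) = 1 \<and> (1, 1) \<in> ?D"
    unfolding square_components_def
    using card_quotient_eq_1_iff[OF equiv_connected_in corner] corner by blast
next
  let ?D = "diagram n \<pi>"
  assume one: "card (square_components ?D) = 1 \<and> (1, 1) \<in> ?D"
  show "avoids_pattern 3 pattern132 n \<pi>"
    unfolding avoids_pattern_def contains_pattern132_iff
  proof clarify
    fix a b c
    assume abc: "1 \<le> a" "a < b" "b < c" "c \<le> n" "\<pi> a < \<pi> c" "\<pi> c < \<pi> b"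
    have "\<pi> c \<in> {1..n}"
      using permutes_in_image[OF assms(1), of c] abc by simp
    then have bc: "(b, \<pi> c) \<in> ?D"
      using abc by (simp add: mem_diagram_iff[OF assms(1)] permutes_inverses(2)[OF assms(1)])
    have "\<forall>q\<in>?D. ((b, \<pi> c), q) \<in> connected_in ?D"
      using one card_quotient_eq_1_iff[OF equiv_connected_in bc]
      unfolding square_components_def by blast
    then have "((b, \<pi> c), (1, 1)) \<in> (edge_adjacent \<inter> ?D \<times> ?D)\<^sup>*"
      using one by (auto simp: connected_in_def)
    from rtrancl_diagram_stays_southeast_of_dot[OF assms(1) this, of a] abc
    show False by simp
  qed
qed

end
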